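(* Let $f:\mathbb{R}^n\to\mathbb{R}^n$, $g:\mathbb{R}^n\to\mathbb{R}^{n\times m}$, $h:\mathbb{R}^n\to\mathbb{R}$, the set $\mathcal{C}=\{x: h(x)\ge 0\}$, the open set $\mathcal{D}_0\supseteq\mathcal{C}$ and the function $V:\mathcal{D}_0\to\mathbb{R}$ be as in the context. Suppose that the Strict Compatibility assumption holds, and that either the Small Control Property or the Stabilizable Linearization assumption holds (all three are stated in the context). Then there exist an open set $\mathcal{D}\subseteq\mathbb{R}^n$ with $\mathcal{C}\subseteq\mathcal{D}$ and a continuously differentiable function $W:\mathcal{D}\to\mathbb{R}$ which is a control Lyapunov-barrier function (CLBF) on $\mathcal{D}$ for $\dot x=f(x)+g(x)u$ with respect to $\mathcal{C}$; that is, $W$ is positive definite on $\mathcal{D}$ and 1. $\inf_{u\in\mathbb{R}^m}\nabla W(x)^\top[f(x)+g(x)u]<0$ for all $x\in\mathcal{D}\setminus\{0\}$; 2. $\{x\in\mathcal{D}: W(x)\le 1\}=\mathcal{C}$; 3. $\{x\in\mathcal{D}: W(x)=1\}=\partial\mathcal{C}$.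
   Context: Setting. Consider the control-affine system $\dot x=f(x)+g(x)u$ with $f:\mathbb{R}^n\to\mathbb{R}^n$ and $g:\mathbb{R}^n\to\mathbb{R}^{n\times m}$ continuous on $\mathbb{R}^n$ and continuously differentiable except possibly at the origin, and $f(0)=0$. The function $h:\mathbb{R}^n\to\mathbb{R}$ is continuously differentiable, and the safe set is $\mathcal{C}=\{x\in\mathbb{R}^n: h(x)\ge 0\}$, with $\partial\mathcal{C}=\{x\in\mathbb{R}^n: h(x)=0\}$. Notation. $L_fV(x)=\nabla V(x)^\top f(x)$ and $L_gV(x)=\nabla V(x)^\top g(x)$, and similarly for $h$. A function $W:\mathcal{D}\to\mathbb{R}$ on an open set $\mathcal{D}$ containing $0$ is positive definite on $\mathcal{D}$ if $W(0)=0$ and $W(x)>0$ for $x\in\mathcal{D}\setminus\{0\}$. Strict Compatibility. The set $\mathcal{C}$ is compact and contains the origin in its interior; $\mathcal{D}_0$ is an open set containing $\mathcal{C}$ and $V:\mathcal{D}_0\to\mathbb{R}$ is continuously differentiable; and: (1) for every $x\in\mathcal{D}_0\setminus\{0\}$ there exists $u\in\mathbb{R}^m$ with $L_fV(x)+L_gV(x)u<0$; (2) for every $x\in\partial\mathcal{C}$ there exists a single $u\in\mathbb{R}^m$ with both $L_fV(x)+L_gV(x)u<0$ and $L_fh(x)+L_gh(x)u>0$. Stabilizable Linearization. $f$ and $g$ are continuously differentiable; with $A:=\frac{\partial f}{\partial x}(0)$ and $B:=g(0)$, the pair $(A,B)$ is stabilizable; and, with $P=\nabla^2V(0)$ (assumed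 to exist), there exists $K\in\mathbb{R}^{m\times n}$ such that $\bar A:=A+BK$ is Hurwitz and $P\bar A+\bar A^\top P$ is negative definite. Small Control Property. For each $\varepsilon>0$ there exists $\delta>0$ such that, if $x\ne 0$ and $|x|<\delta$, then there exists $u\in\mathbb{R}^m$ with $|u|<\varepsilon$ and $L_fV(x)+L_gV(x)u<0$. *)

theory Defs
  imports "HOL-Analysis.Analysis"
begin

section \<open>Calculus\<close>

text \<open>Meant for open \<open>S\<close> only: the derivative at a point of \<open>S\<close> is unrestricted,
  and its continuity is with respect to the operator norm.\<close>

definition C1_on ::
    "'a::real_normed_vector set \<Rightarrow> ('a \<Rightarrow> 'b::real_normed_vector) \<Rightarrow> bool" where
  "C1_on S F \<longleftrightarrow>
     (\<exists>F'. (\<forall>x\<in>S. (F has_derivative blinfun_apply (F' x)) (at x)) \<and> continuous_on S F')"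

text \<open>The value is unspecified where \<open>V\<close> is not differentiable.\<close>

definition grad :: "(real^'n \<Rightarrow> real) \<Rightarrow> real^'n \<Rightarrow> real^'n" where
  "grad V x = (THE D. GDERIV V x :> D)"

lemma grad_eqI:
  assumes "GDERIV V x :> D"
  shows "grad V x = D"
  unfolding grad_def
proof (rule the_equality)
  fix D' assume "GDERIV V x :> D'"
  then have "(\<lambda>h. inner h D') = (\<lambda>h. inner h D)"
    using assms has_derivative_unique unfolding gderiv_def by blast
  then have "\<forall>h. inner h D' = inner h D"
    by meson
  then show "D' = D"
    by (simp add: vector_eq_ldot)
qed (rule assms)

definition hessian :: "(real^'n \<Rightarrow> real) \<Rightarrow> real^'n \<Rightarrow> real^'n^'n" where
  "hessian V x = jacobian (grad V) (at x)"

text \<open>\<open>L_fV(x)\<close> is \<open>lie f V x\<close>; the row vector \<open>L_gV(x)\<close> is \<open>lie_row g V x\<close>, so that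
  \<open>L_gV(x)u\<close> becomes an inner product with \<open>u\<close>.\<close>

definition lie :: "(real^'n \<Rightarrow> real^'n) \<Rightarrow> (real^'n \<Rightarrow> real) \<Rightarrow> real^'n \<Rightarrow> real" where
  "lie f V x = grad V x \<bullet> f x"

definition lie_row :: "(real^'n \<Rightarrow> real^'m^'n) \<Rightarrow> (real^'n \<Rightarrow> real) \<Rightarrow> real^'n \<Rightarrow> real^'m" where
  "lie_row g V x = grad V x v* g x"

definition positive_definite_on :: "(real^'n) set \<Rightarrow> (real^'n \<Rightarrow> real) \<Rightarrow> bool" where
  "positive_definite_on D W \<longleftrightarrow>
     open D \<and> 0 \<in> D \<and> W 0 = 0 \<and> (\<forall>x \<in> D - {0}. W x > 0)"

section \<open>Matrices\<close>

definition hurwitz :: "real^'n^'n \<Rightarrow> bool" where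
  "hurwitz M \<longleftrightarrow>
     (\<forall>c::complex. (\<exists>v. v \<noteq> 0 \<and> map_matrix complex_of_real M *v v = c *s v) \<longrightarrow> Re c < 0)"

definition stabilizable :: "real^'n^'n \<Rightarrow> real^'m^'n \<Rightarrow> bool" where
  "stabilizable A B \<longleftrightarrow> (\<exists>K::real^'n^'m. hurwitz (A + B ** K))"

text \<open>Symmetry is not part of the definition; it is automatic for the matrix
  \<open>P ** A' + transpose A' ** P\<close> below, as the Hessian \<open>P\<close> is symmetric.\<close>

definition negative_definite :: "real^'n^'n \<Rightarrow> bool" where
  "negative_definite M \<longleftrightarrow> (\<forall>x. x \<noteq> 0 \<longrightarrow> x \<bullet> (M *v x) < 0)"

section \<open>Control systems\<close>

definition safe_set :: "(real^'n \<Rightarrow> real) \<Rightarrow> (real^'n) set" where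
  "safe_set h = {x. h x \<ge> 0}"

text \<open>Functions defined on an open set are represented by total functions; only the values on
  that set matter.\<close>

definition strict_compatibility ::
    "(real^'n \<Rightarrow> real^'n) \<Rightarrow> (real^'n \<Rightarrow> real^'m^'n) \<Rightarrow> (real^'n \<Rightarrow> real) \<Rightarrow>
     (real^'n) set \<Rightarrow> (real^'n \<Rightarrow> real) \<Rightarrow> bool" where
  "strict_compatibility f g h D0 V \<longleftrightarrow>
     compact (safe_set h) \<and> 0 \<in> interior (safe_set h) \<and>
     open D0 \<and> safe_set h \<subseteq> D0 \<and> C1_on D0 V \<and>
     (\<forall>x \<in> D0 - {0}. \<exists>u. lie f V x + lie_row g V x \<bullet> u < 0) \<and>
     (\<forall>x \<in> frontier (safe_set h). \<exists>u.
        lie f V x + lie_row g V x \<bullet> u < 0 \<and> lie f h x + lie_row g h x \<bullet> u > 0)"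

text \<open>Existence of \<open>\<nabla>\<^sup>2V(0)\<close> means that the gradient is Frechet differentiable at the origin.\<close>

definition stabilizable_linearization ::
    "(real^'n \<Rightarrow> real^'n) \<Rightarrow> (real^'n \<Rightarrow> real^'m^'n) \<Rightarrow> (real^'n \<Rightarrow> real) \<Rightarrow> bool" where
  "stabilizable_linearization f g V \<longleftrightarrow>
     C1_on UNIV f \<and> C1_on UNIV g \<and>
     grad V differentiable (at 0) \<and>
     (let A = jacobian f (at 0); B = g 0; P = hessian V 0 in
        stabilizable A B \<and>
        (\<exists>K::real^'n^'m. let A' = A + B ** K in
           hurwitz A' \<and> negative_definite (P ** A' + transpose A' ** P)))"

text \<open>The restriction to \<open>D0\<close>, the domain of \<open>V\<close>, is harmless since \<open>\<delta>\<close> may be shrunk.\<close>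

definition small_control_property ::
    "(real^'n \<Rightarrow> real^'n) \<Rightarrow> (real^'n \<Rightarrow> real^'m^'n) \<Rightarrow> (real^'n) set \<Rightarrow>
     (real^'n \<Rightarrow> real) \<Rightarrow> bool" where
  "small_control_property f g D0 V \<longleftrightarrow>
     (\<forall>\<epsilon>>0. \<exists>\<delta>>0. \<forall>x\<in>D0. x \<noteq> 0 \<and> norm x < \<delta> \<longrightarrow>
        (\<exists>u. norm u < \<epsilon> \<and> lie f V x + lie_row g V x \<bullet> u < 0))"

text \<open>The infimum is taken in the extended reals, since it is \<open>-\<infinity>\<close> wherever \<open>L_gW(x) \<noteq> 0\<close>.\<close>

definition clbf ::
    "(real^'n \<Rightarrow> real^'n) \<Rightarrow> (real^'n \<Rightarrow> real^'m^'n) \<Rightarrow> (real^'n) set \<Rightarrow>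
     (real^'n) set \<Rightarrow> (real^'n \<Rightarrow> real) \<Rightarrow> bool" where
  "clbf f g C D W \<longleftrightarrow>
     positive_definite_on D W \<and>
     (\<forall>x \<in> D - {0}. (INF u. ereal (grad W x \<bullet> (f x + g x *v u))) < 0) \<and>
     {x \<in> D. W x \<le> 1} = C \<and>
     {x \<in> D. W x = 1} = frontier C"

end

theory Submission
  imports Defs
begin

text \<open>
  Let \<open>C = safe_set h\<close>, and add a constant to \<open>V\<close> so that \<open>V 0 = 0\<close>. The CLBF is given by an
  explicit formula
    \<open>W x = 1 - q (h x) * (1 - a * V x)\<close>,
  where \<open>a > 0\<close> is so small that \<open>a * V < 1\<close> on \<open>C\<close>, and \<open>q\<close> is a \<open>C\<^sup>1\<close> cutoff that vanishes
  at \<open>0\<close>, increases on \<open>(-\<infinity>, d]\<close> and is constantly \<open>1\<close> on \<open>[d, \<infinity>)\<close>. Since the second factor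
  of the product is positive near \<open>C\<close>, the sign of \<open>1 - W\<close> is that of \<open>h\<close>, which yields the two
  level-set conditions. The gradient is
    \<open>\<nabla>W = a q(h) \<nabla>V - q'(h) (1 - a V) \<nabla>h\<close>.
  Deep inside \<open>C\<close>, where \<open>h \<ge> d\<close>, this is \<open>a \<nabla>V\<close>, and an input that decreases \<open>V\<close> decreases \<open>W\<close>.
  In the layer \<open>0 \<le> h < d\<close> it is a combination of \<open>\<nabla>V\<close> and \<open>-\<nabla>h\<close> with nonnegative
  coefficients, not both zero, and \<open>W\<close> decreases under any input that decreases \<open>V\<close> and increases
  \<open>h\<close> at the same time. Strict compatibility provides such an input at every boundary point; by
  continuity one still exists on a neighbourhood of the compact boundary, hence on the whole layer
  once \<open>d\<close> is small (\<open>boundary_layer\<close>). Another appeal to continuity extends the decrease of \<open>W\<close>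
  to a neighbourhood of \<open>C\<close>.

  Positive definiteness of \<open>W\<close> requires \<open>V > 0\<close> on \<open>C - {0}\<close>, although \<open>V\<close> is not assumed to be
  positive definite. It follows from compactness (\<open>argmin_unless_descent\<close>): at every nonzero point
  of \<open>C\<close> some admissible velocity points into \<open>C\<close> and decreases \<open>V\<close>, so that the minimum of \<open>V\<close>
  over \<open>C\<close> can only be attained at the origin.
\<close>

section \<open>Gradients\<close>

text \<open>The Riesz isomorphism between gradients and derivatives is continuous in both directions, so
  continuity of the derivative in operator norm may be checked on the gradient.\<close>

lemma C1_on_iff_continuous_gradient:
  fixes V :: "'a::euclidean_space \<Rightarrow> real"
  shows "C1_on S V \<longleftrightarrow> (\<exists>G. (\<forall>x\<in>S. GDERIV V x :> G x) \<and> continuous_on S G)"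
proof
  assume "C1_on S V"
  then obtain V' where V': "\<And>x. x \<in> S \<Longrightarrow> (V has_derivative blinfun_apply (V' x)) (at x)"
    and cont: "continuous_on S V'"
    unfolding C1_on_def by blast
  define G where "G x = (\<Sum>b\<in>Basis. blinfun_apply (V' x) b *\<^sub>R b)" for x
  have "y \<bullet> G x = blinfun_apply (V' x) y" for x y
  proof -
    have "blinfun_apply (V' x) y = blinfun_apply (V' x) (\<Sum>b\<in>Basis. (y \<bullet> b) *\<^sub>R b)"
      by (simp add: euclidean_representation)
    also have "\<dots> = y \<bullet> G x"
      unfolding G_def by (simp add: blinfun.sum_right blinfun.scaleR_right inner_sum_right mult.commute)
    finally show ?thesis ..
  qed
  then have "\<forall>x\<in>S. GDERIV V x :> G x"
    using V' unfolding gderiv_def by simp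
  moreover have "continuous_on S G"
    unfolding G_def by (intro continuous_intros cont)
  ultimately show "\<exists>G. (\<forall>x\<in>S. GDERIV V x :> G x) \<and> continuous_on S G" by blast
next
  assume "\<exists>G. (\<forall>x\<in>S. GDERIV V x :> G x) \<and> continuous_on S G"
  then obtain G where G: "\<forall>x\<in>S. GDERIV V x :> G x" and cont: "continuous_on S G" by blast
  have "continuous_on S (\<lambda>x. blinfun_inner_left (G x))"
    by (intro bounded_linear.continuous_on[OF bounded_linear_blinfun_inner_left] cont)
  then show "C1_on S V"
    using G unfolding C1_on_def gderiv_def
    by (intro exI[of _ "\<lambda>x. blinfun_inner_left (G x)"]) simp
qed

lemma C1_on_imp_GDERIV_grad:
  fixes V :: "real^'n \<Rightarrow> real"
  assumes "C1_on S V"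
  shows "x \<in> S \<Longrightarrow> GDERIV V x :> grad V x" and "continuous_on S (grad V)"
proof -
  obtain G where G: "\<And>x. x \<in> S \<Longrightarrow> GDERIV V x :> G x" and cont: "continuous_on S G"
    using assms unfolding C1_on_iff_continuous_gradient by blast
  have eq: "grad V x = G x" if "x \<in> S" for x
    using G grad_eqI that by blast
  show "x \<in> S \<Longrightarrow> GDERIV V x :> grad V x"
    using G eq by simp
  show "continuous_on S (grad V)"
    using cont eq continuous_on_cong by force
qed

lemma GDERIV_imp_isCont:
  assumes "GDERIV V x :> D"
  shows "isCont V x"
  using assms has_derivative_continuous unfolding gderiv_def by blast

lemma GDERIV_neg_imp_decreasing:
  fixes V :: "'a::real_inner \<Rightarrow> real"
  assumes "GDERIV V p :> D" and "D \<bullet> v < 0"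
  shows "\<forall>\<^sub>F t in at_right 0. V (p + t *\<^sub>R v) < V p"
proof -
  have V': "(V has_derivative (\<lambda>h. h \<bullet> D)) (at (p + 0 *\<^sub>R v))"
    using assms(1) by (simp add: gderiv_def)
  have line: "((\<lambda>t. p + t *\<^sub>R v) has_derivative (\<lambda>t. t *\<^sub>R v)) (at 0)"
    by (auto intro!: derivative_eq_intros)
  from has_derivative_compose[OF line V']
  have "((\<lambda>t. V (p + t *\<^sub>R v)) has_derivative (\<lambda>t. (t *\<^sub>R v) \<bullet> D)) (at 0)" .
  then have "((\<lambda>t. V (p + t *\<^sub>R v)) has_real_derivative D \<bullet> v) (at 0)"
    by (rule has_derivative_imp_has_field_derivative) (simp add: inner_commute)
  from DERIV_neg_dec_right[OF this assms(2)]
  obtain d where "d > 0" "\<And>t. 0 < t \<Longrightarrow> t < d \<Longrightarrow> V (p + t *\<^sub>R v) < V p"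
    by auto
  then show ?thesis
    unfolding eventually_at_right_field by blast
qed

section \<open>Admissible velocities\<close>

text \<open>Here and below \<open>\<Phi> u\<close> is the vector field generated by the constant input \<open>u\<close>. Continuity
  of each \<open>\<Phi> u\<close> suffices, as a strict inequality that holds for \<open>u\<close> at a point persists nearby for
  the same \<open>u\<close>.\<close>

lemma open_common_descent:
  fixes \<Phi> :: "'u \<Rightarrow> 'a::real_inner \<Rightarrow> 'a"
  assumes "open S" and "\<And>u. continuous_on S (\<Phi> u)"
    and "continuous_on S G" and "continuous_on S H"
  shows "open {x \<in> S. \<exists>u. G x \<bullet> \<Phi> u x < 0 \<and> H x \<bullet> \<Phi> u x < 0}"
proof -
  have "open {x \<in> S. G x \<bullet> \<Phi> u x < 0 \<and> H x \<bullet> \<Phi> u x < 0}" for u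
  proof -
    have "continuous_on S (\<lambda>x. max (G x \<bullet> \<Phi> u x) (H x \<bullet> \<Phi> u x))"
      by (intro continuous_intros assms)
    then have "open (S \<inter> (\<lambda>x. max (G x \<bullet> \<Phi> u x) (H x \<bullet> \<Phi> u x)) -` {..<0})"
      by (intro continuous_open_preimage assms(1) open_lessThan)
    also have "S \<inter> (\<lambda>x. max (G x \<bullet> \<Phi> u x) (H x \<bullet> \<Phi> u x)) -` {..<0}
      = {x \<in> S. G x \<bullet> \<Phi> u x < 0 \<and> H x \<bullet> \<Phi> u x < 0}"
      by auto
    finally show ?thesis .
  qed
  then have "open (\<Union>u. {x \<in> S. G x \<bullet> \<Phi> u x < 0 \<and> H x \<bullet> \<Phi> u x < 0})"
    by blast
  also have "(\<Union>u. {x \<in> S. G x \<bullet> \<Phi> u x < 0 \<and> H x \<bullet> \<Phi> u x < 0})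
      = {x \<in> S. \<exists>u. G x \<bullet> \<Phi> u x < 0 \<and> H x \<bullet> \<Phi> u x < 0}"
    by auto
  finally show ?thesis .
qed

lemma continuous_on_control_affine:
  fixes f :: "'a::topological_space \<Rightarrow> real^'n" and g :: "'a \<Rightarrow> real^'m^'n"
  assumes "continuous_on S f" and "continuous_on S g"
  shows "continuous_on S (\<lambda>x. f x + g x *v u)"
  unfolding matrix_vector_mult_def by (intro continuous_intros assms)

lemma lie_plus_lie_row:
  "lie f V x + lie_row g V x \<bullet> u = grad V x \<bullet> (f x + g x *v u)"
  by (simp add: lie_def lie_row_def dot_lmul_matrix inner_add_right)

text \<open>Compactness turns the strict inequalities on the boundary into a layer of positive width: a
  continuous \<open>h\<close> that is positive on the compact part of \<open>C\<close> outside \<open>U\<close> is bounded away from zero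
  there. The width \<open>d\<close> is kept below \<open>h p\<close>, so that the layer avoids the point \<open>p\<close>, in the
  application the origin.\<close>

lemma boundary_layer:
  fixes h :: "'a::t2_space \<Rightarrow> real"
  assumes "compact C" and "continuous_on C h" and "open U"
    and "\<And>x. x \<in> C \<Longrightarrow> x \<notin> U \<Longrightarrow> h x > 0" and "p \<in> C" and "h p > 0"
  obtains d where "d > 0" and "d \<le> h p" and "\<And>x. x \<in> C \<Longrightarrow> h x < d \<Longrightarrow> x \<in> U"
proof -
  have "compact (insert p (C - U))"
    using assms by (intro compact_insert compact_diff)
  moreover have "continuous_on (insert p (C - U)) h"
    using assms(5) by (intro continuous_on_subset[OF assms(2)]) auto
  ultimately obtain m where m: "m \<in> insert p (C - U)" "\<And>x. x \<in> insert p (C - U) \<Longrightarrow> h m \<le> h x"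
    by (metis continuous_attains_inf insert_not_empty)
  show thesis
  proof (rule that)
    show "h m > 0" using m(1) assms by blast
    show "h m \<le> h p" using m(2) by blast
    show "x \<in> U" if "x \<in> C" "h x < h m" for x
      using m(2)[of x] that by force
  qed
qed

text \<open>A minimiser of \<open>V\<close> over a compact set cannot have a feasible direction of descent. If every
  point but \<open>p\<close> has one, then \<open>p\<close> is the only minimiser.\<close>

lemma argmin_unless_descent:
  fixes V :: "'a::real_inner \<Rightarrow> real"
  assumes "compact C" and "p \<in> C" and "\<And>x. x \<in> C \<Longrightarrow> GDERIV V x :> G x"
    and descent: "\<And>x. x \<in> C \<Longrightarrow> x \<noteq> p \<Longrightarrow>
      \<exists>v. G x \<bullet> v < 0 \<and> (\<forall>\<^sub>F t in at_right 0. x + t *\<^sub>R v \<in> C)"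
    and "x \<in> C" and "x \<noteq> p"
  shows "V p < V x"
proof -
  have only_p: "m = p" if m: "m \<in> C" "\<And>y. y \<in> C \<Longrightarrow> V m \<le> V y" for m
  proof (rule ccontr)
    assume "m \<noteq> p"
    then obtain v where "G m \<bullet> v < 0" and "\<forall>\<^sub>F t in at_right 0. m + t *\<^sub>R v \<in> C"
      using descent m(1) by blast
    moreover from this have "\<forall>\<^sub>F t in at_right 0. V (m + t *\<^sub>R v) < V m"
      using GDERIV_neg_imp_decreasing assms(3) m(1) by blast
    ultimately have "\<forall>\<^sub>F t in at_right (0::real). m + t *\<^sub>R v \<in> C \<and> V (m + t *\<^sub>R v) < V m"
      by (simp add: eventually_conj)
    then have "\<exists>t. m + t *\<^sub>R v \<in> C \<and> V (m + t *\<^sub>R v) < V m"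
      using eventually_happens trivial_limit_at_right_real by blast
    then show False using m(2) by fastforce
  qed
  have "continuous_on C V"
    using GDERIV_imp_isCont[OF assms(3)] by (simp add: continuous_at_imp_continuous_on)
  then obtain m where m: "m \<in> C" "\<And>y. y \<in> C \<Longrightarrow> V m \<le> V y"
    using continuous_attains_inf[OF assms(1)] assms(2) by blast
  have "m = p" using only_p m by blast
  then have "V p \<le> V x" using m assms(5) by blast
  moreover have "V x \<noteq> V p"
    using only_p[of x] m \<open>m = p\<close> assms(5,6) by auto
  ultimately show ?thesis by simp
qed

section \<open>Blending the Lyapunov function with the barrier function\<close>

text \<open>The cutoff of the construction is \<open>q s = 1 - (max 0 (1 - s / d))\<^sup>2\<close>. The square makes it
  \<open>C\<^sup>1\<close> at \<open>s = d\<close>.\<close>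

lemma DERIV_max_0_squared:
  "((\<lambda>y::real. (max 0 y)\<^sup>2) has_real_derivative 2 * max 0 y) (at y)"
proof (cases y "0::real" rule: linorder_cases)
  case less
  have "((\<lambda>y::real. 0) has_real_derivative 0) (at y)" by simp
  then have "((\<lambda>y::real. (max 0 y)\<^sup>2) has_real_derivative 0) (at y)"
    by (rule has_field_derivative_transform_within_open[where S = "{..<0}"]) (use less in auto)
  then show ?thesis using less by simp
next
  case equal
  have "((\<lambda>k. max 0 k) \<longlongrightarrow> max 0 (0::real)) (at 0)"
    by (intro tendsto_intros)
  moreover have "((max 0 (0 + k))\<^sup>2 - (max 0 (0::real))\<^sup>2) / k = max 0 k" for k :: real
    by (auto simp: max_def power2_eq_square)
  ultimately show ?thesis using equal by (simp add: DERIV_def)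
next
  case greater
  have "((\<lambda>y::real. y\<^sup>2) has_real_derivative 2 * y) (at y)"
    by (auto intro!: derivative_eq_intros)
  then have "((\<lambda>y::real. (max 0 y)\<^sup>2) has_real_derivative 2 * y) (at y)"
    by (rule has_field_derivative_transform_within_open[where S = "{0<..}"]) (use greater in auto)
  then show ?thesis using greater by simp
qed

definition cutoff :: "real \<Rightarrow> real \<Rightarrow> real" where
  "cutoff d s = 1 - (max 0 (1 - s / d))\<^sup>2"

definition cutoff_deriv :: "real \<Rightarrow> real \<Rightarrow> real" where
  "cutoff_deriv d s = 2 / d * max 0 (1 - s / d)"

lemma DERIV_cutoff: "(cutoff d has_real_derivative cutoff_deriv d s) (at s)"
proof -
  have "((\<lambda>s. 1 - s / d) has_real_derivative - (1 / d)) (at s)"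
    unfolding divide_inverse by (auto intro!: derivative_eq_intros)
  from DERIV_chain2[OF DERIV_max_0_squared this]
  have "((\<lambda>s. 1 - (max 0 (1 - s / d))\<^sup>2) has_real_derivative
      0 - 2 * max 0 (1 - s / d) * - (1 / d)) (at s)"
    by (intro DERIV_diff DERIV_const)
  then show ?thesis by (simp add: cutoff_def[abs_def] cutoff_deriv_def)
qed

lemma continuous_on_cutoff:
  "continuous_on S k \<Longrightarrow> continuous_on S (\<lambda>x. cutoff d (k x))"
  "continuous_on S k \<Longrightarrow> continuous_on S (\<lambda>x. cutoff_deriv d (k x))"
  unfolding cutoff_def cutoff_deriv_def divide_inverse by (intro continuous_intros; assumption)+

lemma cutoff_le_1: "cutoff d s \<le> 1"
  by (simp add: cutoff_def)

lemma cutoff_plateau: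
  assumes "d > 0" and "d \<le> s"
  shows "cutoff d s = 1" and "cutoff_deriv d s = 0"
  using assms by (simp_all add: cutoff_def cutoff_deriv_def max_def)

lemma cutoff_deriv_pos: "d > 0 \<Longrightarrow> s < d \<Longrightarrow> cutoff_deriv d s > 0"
  unfolding cutoff_deriv_def by (intro mult_pos_pos) simp_all

lemma sgn_cutoff:
  assumes "d > 0"
  shows "sgn (cutoff d s) = sgn s"
proof (cases s "0::real" rule: linorder_cases)
  case less
  then have "1 - s / d > 1" using assms by (simp add: divide_less_0_iff)
  then have "(max 0 (1 - s / d))\<^sup>2 > 1" by (simp add: one_less_power)
  then show ?thesis using less by (simp add: cutoff_def)
next
  case equal
  then show ?thesis by (simp add: cutoff_def)
next
  case greater
  then have "max 0 (1 - s / d) < 1" using assms by simp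
  then have "(max 0 (1 - s / d))\<^sup>2 < 1" by (simp add: power_less_one_iff abs_square_less_1)
  then show ?thesis using greater by (simp add: cutoff_def)
qed

definition blend :: "real \<Rightarrow> real \<Rightarrow> ('a \<Rightarrow> real) \<Rightarrow> ('a \<Rightarrow> real) \<Rightarrow> 'a \<Rightarrow> real" where
  "blend d a h V x = 1 - cutoff d (h x) * (1 - a * V x)"

lemma GDERIV_blend:
  assumes "GDERIV V x :> G" and "GDERIV h x :> H"
  shows "GDERIV (blend d a h V) x :>
    (a * cutoff d (h x)) *\<^sub>R G - (cutoff_deriv d (h x) * (1 - a * V x)) *\<^sub>R H"
proof -
  have q: "GDERIV (\<lambda>x. cutoff d (h x)) x :> cutoff_deriv d (h x) *\<^sub>R H"
    by (rule GDERIV_DERIV_compose[OF assms(2) DERIV_cutoff])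
  have r: "GDERIV (\<lambda>x. 1 - a * V x) x :> 0 - (a *\<^sub>R G + V x *\<^sub>R 0)"
    by (intro GDERIV_diff GDERIV_const GDERIV_mult assms(1))
  show ?thesis
    unfolding blend_def
    by (rule GDERIV_subst[OF GDERIV_diff[OF GDERIV_const GDERIV_mult[OF q r]]])
      (simp add: algebra_simps)
qed

lemma blend_vs_1:
  assumes "d > 0" and "a * V x < 1"
  shows "blend d a h V x \<le> 1 \<longleftrightarrow> h x \<ge> 0" and "blend d a h V x = 1 \<longleftrightarrow> h x = 0"
proof -
  have pos: "1 - a * V x > 0" using assms(2) by simp
  have sgn: "sgn (cutoff d (h x)) = sgn (h x)" by (rule sgn_cutoff[OF assms(1)])
  have "cutoff d (h x) \<ge> 0 \<longleftrightarrow> h x \<ge> 0" "cutoff d (h x) = 0 \<longleftrightarrow> h x = 0"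
    using sgn by (auto simp: sgn_if split: if_splits)
  then show "blend d a h V x \<le> 1 \<longleftrightarrow> h x \<ge> 0" and "blend d a h V x = 1 \<longleftrightarrow> h x = 0"
    using pos by (auto simp: blend_def zero_le_mult_iff)
qed

lemma blend_pos:
  assumes "d > 0" and "a > 0" and "a * V x < 1" and "h x \<ge> 0 \<Longrightarrow> V x > 0"
  shows "blend d a h V x > 0"
proof (cases "h x \<ge> 0")
  case True
  then have "0 < a * V x" using assms by simp
  moreover have "cutoff d (h x) * (1 - a * V x) \<le> 1 * (1 - a * V x)"
    using assms(3) cutoff_le_1 by (intro mult_right_mono) auto
  ultimately show ?thesis by (simp add: blend_def)
next
  case False
  then show ?thesis using blend_vs_1(1)[where x = x and V = V and h = h, OF assms(1,3)] by simp
qed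

text \<open>On the layer \<open>0 \<le> h < d\<close> it is \<open>\<nabla>h\<close> that always enters with a nonzero coefficient; on the
  boundary it is the only term left.\<close>

lemma blend_descent:
  fixes G H v :: "'a::real_inner" and d a w s :: real
  assumes "d > 0" and "a > 0" and "a * w < 1" and "s \<ge> 0"
    and "G \<bullet> v < 0" and "s < d \<Longrightarrow> H \<bullet> v > 0"
  shows "((a * cutoff d s) *\<^sub>R G - (cutoff_deriv d s * (1 - a * w)) *\<^sub>R H) \<bullet> v < 0"
proof (cases "s < d")
  case True
  have "cutoff d s \<ge> 0"
    using sgn_cutoff[OF assms(1), of s] assms(4) by (auto simp: sgn_if split: if_splits)
  then have "(a * cutoff d s) * (G \<bullet> v) \<le> 0"
    using assms by (simp add: mult_le_0_iff)
  moreover have "(cutoff_deriv d s * (1 - a * w)) * (H \<bullet> v) > 0"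
    using assms True by (simp add: cutoff_deriv_pos)
  ultimately show ?thesis by (simp add: inner_diff_left)
next
  case False
  then show ?thesis using assms by (simp add: cutoff_plateau mult_less_0_iff)
qed

section \<open>The control Lyapunov-barrier function\<close>

lemma INF_ereal_less_0_iff:
  "(INF u. ereal (\<phi> u)) < 0 \<longleftrightarrow> (\<exists>u. \<phi> u < 0)"
  by (simp add: INF_less_iff)

theorem theorem1:
  fixes f :: "real^'n \<Rightarrow> real^'n"
    and g :: "real^'n \<Rightarrow> real^'m^'n"
    and h V :: "real^'n \<Rightarrow> real"
    and D0 :: "(real^'n) set"
  assumes "continuous_on UNIV f" and "C1_on (- {0}) f" and "f 0 = 0"
    and "continuous_on UNIV g" and "C1_on (- {0}) g"
    and "C1_on UNIV h"
    and "frontier (safe_set h) = {x. h x = 0}"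
    and "strict_compatibility f g h D0 V"
    and "small_control_property f g D0 V \<or> stabilizable_linearization f g V"
  shows "\<exists>D W. open D \<and> safe_set h \<subseteq> D \<and> C1_on D W \<and> clbf f g (safe_set h) D W"
proof -
  let ?C = "safe_set h"
  define \<Phi> where "\<Phi> u x = f x + g x *v u" for u x
  have cont_\<Phi>: "continuous_on S (\<Phi> u)" for S u
    unfolding \<Phi>_def[abs_def]
    by (intro continuous_on_control_affine continuous_on_subset[OF assms(1)]
        continuous_on_subset[OF assms(4)] subset_UNIV)

  have compactC: "compact ?C" and int0: "0 \<in> interior ?C"
    and openD0: "open D0" and CD0: "?C \<subseteq> D0" and C1V: "C1_on D0 V"
    and descV: "\<And>x. x \<in> D0 \<Longrightarrow> x \<noteq> 0 \<Longrightarrow> \<exists>u. grad V x \<bullet> \<Phi> u x < 0"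
    and compat: "\<And>x. h x = 0 \<Longrightarrow> \<exists>u. grad V x \<bullet> \<Phi> u x < 0 \<and> grad h x \<bullet> \<Phi> u x > 0"
    using assms(7,8) unfolding strict_compatibility_def lie_plus_lie_row \<Phi>_def by auto
  have C_iff: "x \<in> ?C \<longleftrightarrow> h x \<ge> 0" for x
    by (simp add: safe_set_def)
  have int_iff: "x \<in> interior ?C \<longleftrightarrow> h x > 0" for x
  proof -
    have "?C - interior ?C = {x. h x = 0}"
      using assms(7) compactC by (simp add: frontier_def compact_imp_closed)
    then have "x \<in> ?C - interior ?C \<longleftrightarrow> h x = 0" by auto
    moreover have "x \<in> interior ?C \<Longrightarrow> x \<in> ?C" using interior_subset by blast
    ultimately show ?thesis using C_iff[of x] by (auto simp: less_le)
  qed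
  have C0: "0 \<in> ?C" using int0 interior_subset by blast
  have dV: "GDERIV V x :> grad V x" if "x \<in> D0" for x
    using C1_on_imp_GDERIV_grad(1)[OF C1V that] .
  have dh: "GDERIV h x :> grad h x" for x
    using C1_on_imp_GDERIV_grad(1)[OF assms(6)] by simp
  have cont_gradV: "continuous_on D0 (grad V)"
    using C1_on_imp_GDERIV_grad(2)[OF C1V] .
  have cont_gradh: "continuous_on S (grad h)" for S
    by (rule continuous_on_subset[OF C1_on_imp_GDERIV_grad(2)[OF assms(6)] subset_UNIV])
  have cont_V: "continuous_on D0 V"
    using GDERIV_imp_isCont[OF dV] by (simp add: continuous_at_imp_continuous_on)
  have cont_h: "continuous_on S h" for S
    using GDERIV_imp_isCont[OF dh] by (simp add: continuous_at_imp_continuous_on)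

  have Vmin: "V 0 < V x" if x: "x \<in> ?C" "x \<noteq> 0" for x
  proof (rule argmin_unless_descent[OF compactC C0 _ _ x])
    show "GDERIV V y :> grad V y" if "y \<in> ?C" for y
      using dV CD0 that by blast
    show "\<exists>v. grad V y \<bullet> v < 0 \<and> (\<forall>\<^sub>F t in at_right 0. y + t *\<^sub>R v \<in> ?C)"
      if y: "y \<in> ?C" "y \<noteq> 0" for y
    proof (cases "h y = 0")
      case True
      \<comment> \<open>Increasing \<open>h\<close> is what makes this velocity point into \<open>?C\<close>.\<close>
      then obtain u where u: "grad V y \<bullet> \<Phi> u y < 0" "grad h y \<bullet> \<Phi> u y > 0"
        using compat by blast
      have "\<forall>\<^sub>F t in at_right 0. - h (y + t *\<^sub>R \<Phi> u y) < - h y"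
        by (rule GDERIV_neg_imp_decreasing[OF GDERIV_minus[OF dh]]) (use u in simp)
      then have "\<forall>\<^sub>F t in at_right 0. y + t *\<^sub>R \<Phi> u y \<in> ?C"
        by (rule eventually_mono) (simp add: True C_iff)
      then show ?thesis using u by blast
    next
      case False
      then have "y \<in> interior ?C" using y by (simp add: int_iff C_iff)
      obtain u where u: "grad V y \<bullet> \<Phi> u y < 0"
        using descV CD0 y by blast
      have "((\<lambda>t. y + t *\<^sub>R \<Phi> u y) \<longlongrightarrow> y + 0 *\<^sub>R \<Phi> u y) (at_right 0)"
        by (intro tendsto_intros)
      then have "\<forall>\<^sub>F t in at_right 0. y + t *\<^sub>R \<Phi> u y \<in> interior ?C"
        using \<open>y \<in> interior ?C\<close> topological_tendstoD by fastforce
      then have "\<forall>\<^sub>F t in at_right 0. y + t *\<^sub>R \<Phi> u y \<in> ?C"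
        by (rule eventually_mono) (use interior_subset in blast)
      then show ?thesis using u by blast
    qed
  qed

  define V0 where "V0 x = V x - V 0" for x
  have dV0: "GDERIV V0 x :> grad V x" if "x \<in> D0" for x
    unfolding V0_def[abs_def]
    using GDERIV_diff[OF dV[OF that] GDERIV_const] by simp
  have cont_V0: "continuous_on D0 V0"
    unfolding V0_def[abs_def] by (intro continuous_intros cont_V)
  obtain a where a: "a > 0" "\<And>x. x \<in> ?C \<Longrightarrow> a * V0 x < 1"
  proof -
    obtain z where z: "z \<in> ?C" "\<And>x. x \<in> ?C \<Longrightarrow> V0 x \<le> V0 z"
      using continuous_attains_sup[OF compactC _ continuous_on_subset[OF cont_V0 CD0]] C0 by blast
    have "V0 z \<ge> 0" using z(2)[OF C0] by (simp add: V0_def)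
    show thesis
    proof (rule that[of "1 / (V0 z + 1)"])
      show "1 / (V0 z + 1) > 0" using \<open>V0 z \<ge> 0\<close> by simp
      show "1 / (V0 z + 1) * V0 x < 1" if "x \<in> ?C" for x
        using z(2)[OF that] \<open>V0 z \<ge> 0\<close> by (simp add: field_simps)
    qed
  qed

  define U where "U = {x \<in> D0. \<exists>u. grad V x \<bullet> \<Phi> u x < 0 \<and> - grad h x \<bullet> \<Phi> u x < 0}"
  have "open U"
    unfolding U_def
    by (intro open_common_descent openD0 cont_\<Phi> cont_gradV continuous_on_minus cont_gradh)
  moreover have "h x > 0" if "x \<in> ?C" "x \<notin> U" for x
  proof -
    have "h x \<noteq> 0" using compat[of x] that CD0 by (auto simp: U_def)
    then show ?thesis using that(1) by (simp add: C_iff)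
  qed
  moreover have "h 0 > 0" using int0 int_iff by blast
  ultimately obtain d where d: "d > 0" "d \<le> h 0" "\<And>x. x \<in> ?C \<Longrightarrow> h x < d \<Longrightarrow> x \<in> U"
    using boundary_layer[OF compactC cont_h _ _ C0] by blast

  define W where "W = blend d a h V0"
  define GW where "GW x = (a * cutoff d (h x)) *\<^sub>R grad V x
      - (cutoff_deriv d (h x) * (1 - a * V0 x)) *\<^sub>R grad h x" for x
  have dW: "GDERIV W x :> GW x" if "x \<in> D0" for x
    unfolding W_def GW_def by (rule GDERIV_blend[OF dV0[OF that] dh])
  have cont_GW: "continuous_on D0 GW"
    unfolding GW_def[abs_def]
    by (intro continuous_intros continuous_on_cutoff cont_h cont_gradV cont_gradh cont_V0)

  have descent: "\<exists>u. GW x \<bullet> \<Phi> u x < 0" if x: "x \<in> ?C" "x \<noteq> 0" for x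
  proof -
    obtain u where "grad V x \<bullet> \<Phi> u x < 0" "h x < d \<Longrightarrow> grad h x \<bullet> \<Phi> u x > 0"
    proof (cases "h x < d")
      case True
      then show thesis using d(3) x that by (auto simp: U_def)
    next
      case False
      then show thesis using descV x CD0 that by blast
    qed
    then show ?thesis
      using blend_descent[OF d(1) a(1) a(2)[OF x(1)], of "h x"] x(1) unfolding GW_def C_iff by blast
  qed

  define Q where "Q = {x \<in> D0. \<exists>u. GW x \<bullet> \<Phi> u x < 0}"
  define R where "R = {x \<in> D0. a * V0 x < 1}"
  \<comment> \<open>The origin, where \<open>W\<close> does not decrease, is restored by adding the interior of \<open>?C\<close>.\<close>
  define D where "D = R \<inter> (Q \<union> interior ?C)"
  have "open Q"
    using open_common_descent[OF openD0 cont_\<Phi> cont_GW cont_GW] by (simp add: Q_def)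
  moreover have "open R"
  proof -
    have "open (D0 \<inter> (\<lambda>x. a * V0 x) -` {..<1})"
      by (intro continuous_open_preimage continuous_intros cont_V0 openD0 open_lessThan)
    also have "D0 \<inter> (\<lambda>x. a * V0 x) -` {..<1} = R" by (auto simp: R_def)
    finally show ?thesis .
  qed
  ultimately have openD: "open D" unfolding D_def by blast
  have CQ: "?C - {0} \<subseteq> Q" using descent CD0 by (auto simp: Q_def)
  have CD: "?C \<subseteq> D" using CQ CD0 a(2) int0 by (auto simp: D_def R_def)
  have DQ: "D - {0} \<subseteq> Q" using CQ interior_subset by (auto simp: D_def)
  have DR: "x \<in> D0" "a * V0 x < 1" if "x \<in> D" for x
    using that by (auto simp: D_def R_def)

  have "C1_on D W"
    unfolding C1_on_iff_continuous_gradient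
    using dW DR(1) continuous_on_subset[OF cont_GW, of D] by blast
  moreover have "clbf f g ?C D W"
    unfolding clbf_def
  proof (intro conjI ballI)
    show "positive_definite_on D W"
      unfolding positive_definite_on_def
    proof (intro conjI ballI)
      show "W 0 = 0"
        using cutoff_plateau(1)[OF d(1,2)] by (simp add: W_def blend_def V0_def)
      show "W x > 0" if "x \<in> D - {0}" for x
        unfolding W_def using that DR(2) Vmin
        by (intro blend_pos d(1) a(1)) (auto simp: V0_def C_iff)
    qed (use openD CD C0 in auto)
    show "(INF u. ereal (grad W x \<bullet> (f x + g x *v u))) < 0" if x: "x \<in> D - {0}" for x
    proof -
      have "grad W x = GW x" using dW DR(1) x grad_eqI by blast
      then show ?thesis
        using DQ x by (auto simp: INF_ereal_less_0_iff Q_def \<Phi>_def)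
    qed
    have level: "W x \<le> 1 \<longleftrightarrow> h x \<ge> 0" "W x = 1 \<longleftrightarrow> h x = 0" if "x \<in> D" for x
      unfolding W_def by (rule blend_vs_1[where V = V0, OF d(1) DR(2)[OF that]])+
    show "{x \<in> D. W x \<le> 1} = ?C"
      using CD level(1) by (auto simp: C_iff)
    show "{x \<in> D. W x = 1} = frontier ?C"
    proof -
      have "x \<in> D" if "h x = 0" for x
        using CD C_iff[of x] that by auto
      then show ?thesis unfolding assms(7) using level(2) by blast
    qed
  qed
  ultimately show ?thesis using openD CD by blast
qed

end
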